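(* Let $n\ge 1$, let $\Gamma:\mathbb R^n\times\mathbb R^n\to\mathbb R^n$ be a symmetric bilinear map, let $\nabla$ be the symmetric connection on $\mathbb R^n$ given by $\nabla_XY=\mathrm dY(X)+\Gamma(X,Y)$ for smooth vector fields $X,Y$ on $\mathbb R^n$, and let $\mathcal S\subset\mathrm{Lin}(\mathbb R^n)$ be the range of the linear map $v\mapsto\Gamma(v,\cdot)$. A nondegenerate symmetric bilinear form $g_0$ on $T_0\mathbb R^n\cong\mathbb R^n$ extends to a semi-Riemannian metric $g$ on $\mathbb R^n$ having $\nabla$ as its Levi-Civita connection if and only if $$(\mathrm{ad}_X)^k[Y,Z]\in\mathfrak{so}(g_0)$$ for all $X,Y,Z\in\mathcal S$ and all integers $k\ge0$.
   Context: $\mathrm{Lin}(\mathbb R^n)$ is the space of linear endomorphisms of $\mathbb R^n$; for $X,Y\in\mathrm{Lin}(\mathbb R^n)$, $\mathrm{ad}_X(Y)=[X,Y]=XY-YX$. $\mathfrak{so}(g_0)$ is the Lie algebra of all $g_0$-anti-symmetric endomorphisms $A$ of $\mathbb R^n$, i.e. $g_0(A\xi,\eta)+g_0(\xi,A\eta)=0$ for all $\xi,\eta$. A semi-Riemannian metric is a smooth, globally defined, symmetric bilinear form field on the tangent spaces that is nondegenerate at each point (no definiteness required). "$g_0$ extends to $g$" means that the value of $g$ at the origin is $g_0$. A symmetric (torsion-free) connection $\nabla$ is the Levi-Civita connection of $g$ when $\nabla g=0$. *)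

theory Defs
  imports "HOL-Analysis.Analysis"
begin

text \<open>
  Tangent spaces of \<open>\<real>\<^sup>n\<close> are identified with \<open>\<real>\<^sup>n\<close> throughout: a vector field is a map
  \<open>\<real>\<^sup>n \<Rightarrow> \<real>\<^sup>n\<close> and a field of bilinear forms is a map \<open>\<real>\<^sup>n \<Rightarrow> (\<real>\<^sup>n \<Rightarrow> \<real>\<^sup>n \<Rightarrow> \<real>)\<close>.
\<close>

text \<open>
  \<open>Ck k f\<close>: class \<open>C\<^sup>k\<close> on the whole space. In finite dimension, the derivative as an operator-valued
  map is \<open>C\<^sup>k\<close> iff all its evaluations \<open>x \<mapsto> df\<^sub>x(v)\<close> at fixed vectors \<open>v\<close> are.
\<close>

primrec Ck :: "nat \<Rightarrow> ('a::euclidean_space \<Rightarrow> 'b::euclidean_space) \<Rightarrow> bool" where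
  "Ck 0 f \<longleftrightarrow> continuous_on UNIV f"
| "Ck (Suc k) f \<longleftrightarrow>
     (\<forall>x. f differentiable at x) \<and> (\<forall>v. Ck k (\<lambda>x. frechet_derivative f (at x) v))"

definition smooth :: "('a::euclidean_space \<Rightarrow> 'b::euclidean_space) \<Rightarrow> bool" where
  "smooth f \<longleftrightarrow> (\<forall>k. Ck k f)"

definition symmetric_bilinear ::
    "('a::real_vector \<Rightarrow> 'a \<Rightarrow> 'b::real_vector) \<Rightarrow> bool" where
  "symmetric_bilinear B \<longleftrightarrow> bilinear B \<and> (\<forall>u v. B u v = B v u)"

definition nondegenerate :: "('a::real_vector \<Rightarrow> 'a \<Rightarrow> real) \<Rightarrow> bool" where
  "nondegenerate B \<longleftrightarrow> (\<forall>u. (\<forall>v. B u v = 0) \<longrightarrow> u = 0)"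

text \<open>
  Smoothness of the form field is smoothness of its components \<open>x \<mapsto> g\<^sub>x(u, v)\<close> with respect to
  constant vectors.
\<close>

definition semi_riemannian_metric ::
    "('a::euclidean_space \<Rightarrow> 'a \<Rightarrow> 'a \<Rightarrow> real) \<Rightarrow> bool" where
  "semi_riemannian_metric g \<longleftrightarrow>
     (\<forall>u v. smooth (\<lambda>x. g x u v)) \<and>
     (\<forall>x. symmetric_bilinear (g x) \<and> nondegenerate (g x))"

definition connection_of ::
    "('a::euclidean_space \<Rightarrow> 'a \<Rightarrow> 'a) \<Rightarrow> ('a \<Rightarrow> 'a) \<Rightarrow> ('a \<Rightarrow> 'a) \<Rightarrow> 'a \<Rightarrow> 'a" where
  "connection_of \<Gamma> X Y = (\<lambda>x. frechet_derivative Y (at x) (X x) + \<Gamma> (X x) (Y x))"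

definition field_bracket ::
    "('a::euclidean_space \<Rightarrow> 'a) \<Rightarrow> ('a \<Rightarrow> 'a) \<Rightarrow> 'a \<Rightarrow> 'a" where
  "field_bracket X Y =
     (\<lambda>x. frechet_derivative Y (at x) (X x) - frechet_derivative X (at x) (Y x))"

definition torsion_free ::
    "(('a::euclidean_space \<Rightarrow> 'a) \<Rightarrow> ('a \<Rightarrow> 'a) \<Rightarrow> 'a \<Rightarrow> 'a) \<Rightarrow> bool" where
  "torsion_free D \<longleftrightarrow>
     (\<forall>X Y. smooth X \<longrightarrow> smooth Y \<longrightarrow> (\<forall>x. D X Y x - D Y X x = field_bracket X Y x))"

text \<open>\<open>(\<nabla>\<^sub>X g)(Y, Z) = X(g(Y, Z)) - g(\<nabla>\<^sub>X Y, Z) - g(Y, \<nabla>\<^sub>X Z)\<close>\<close>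

definition covariant_derivative_form ::
    "(('a::euclidean_space \<Rightarrow> 'a) \<Rightarrow> ('a \<Rightarrow> 'a) \<Rightarrow> 'a \<Rightarrow> 'a) \<Rightarrow>
     ('a \<Rightarrow> 'a \<Rightarrow> 'a \<Rightarrow> real) \<Rightarrow> ('a \<Rightarrow> 'a) \<Rightarrow> ('a \<Rightarrow> 'a) \<Rightarrow> ('a \<Rightarrow> 'a) \<Rightarrow> 'a \<Rightarrow> real" where
  "covariant_derivative_form D g X Y Z =
     (\<lambda>x. frechet_derivative (\<lambda>p. g p (Y p) (Z p)) (at x) (X x)
           - g x (D X Y x) (Z x) - g x (Y x) (D X Z x))"

definition levi_civita_connection ::
    "('a::euclidean_space \<Rightarrow> 'a \<Rightarrow> 'a \<Rightarrow> real) \<Rightarrow>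
     (('a \<Rightarrow> 'a) \<Rightarrow> ('a \<Rightarrow> 'a) \<Rightarrow> 'a \<Rightarrow> 'a) \<Rightarrow> bool" where
  "levi_civita_connection g D \<longleftrightarrow>
     torsion_free D \<and>
     (\<forall>X Y Z. smooth X \<longrightarrow> smooth Y \<longrightarrow> smooth Z \<longrightarrow>
        (\<forall>x. covariant_derivative_form D g X Y Z x = 0))"

definition ad :: "('a::real_vector \<Rightarrow> 'a) \<Rightarrow> ('a \<Rightarrow> 'a) \<Rightarrow> 'a \<Rightarrow> 'a" where
  "ad X Y = (\<lambda>\<xi>. X (Y \<xi>) - Y (X \<xi>))"

definition so :: "('a::real_vector \<Rightarrow> 'a \<Rightarrow> real) \<Rightarrow> ('a \<Rightarrow> 'a) set" where
  "so B = {A. linear A \<and> (\<forall>\<xi> \<eta>. B (A \<xi>) \<eta> + B \<xi> (A \<eta>) = 0)}"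

end

theory Submission
  imports Defs
begin

text \<open>
  Write \<open>(A \<cdot> B)(u, w) = B(A u, w) + B(u, A w)\<close> for an endomorphism \<open>A\<close> and a bilinear form \<open>B\<close>, so
  that \<open>so(B)\<close> is the annihilator of \<open>B\<close>. Testing \<open>\<nabla>g = 0\<close> on constant vector fields turns it into the
  total differential equation \<open>dg\<^sub>x(v) = \<Gamma>\<^sub>v \<cdot> g\<^sub>x\<close>, linear with constant coefficients. The theorem is
  the integrability criterion of this equation with the prescribed value at the origin. Everything
  rests on the commutator \<open>A \<cdot> (C \<cdot> B) - C \<cdot> (A \<cdot> B) = -[A, C] \<cdot> B\<close>, which has two consequences:
  the actions of \<open>A\<close> and \<open>C\<close> on \<open>B\<close> commute iff \<open>[A, C] \<in> so(B)\<close> (\<open>derived_form_commute_iff\<close>), and an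
  element \<open>C\<close> of \<open>so(B)\<close> lies in \<open>so(A \<cdot> B)\<close> iff \<open>[A, C] \<in> so(B)\<close> (\<open>so_derived_form_iff\<close>).

  Necessity. If \<open>g\<close> is a solution, then the symmetry of its second derivatives says that \<open>\<Gamma>\<^sub>b\<close> and
  \<open>\<Gamma>\<^sub>c\<close> commute on every \<open>g\<^sub>x\<close>, that is, \<open>[\<Gamma>\<^sub>b, \<Gamma>\<^sub>c] \<in> so(g\<^sub>x)\<close>. If a fixed \<open>C\<close> lies in \<open>so(g\<^sub>x)\<close> for all
  \<open>x\<close>, then differentiating \<open>C \<cdot> g\<^sub>x = 0\<close> in the direction \<open>a\<close> puts \<open>C\<close> in \<open>so(\<Gamma>\<^sub>a \<cdot> g\<^sub>x)\<close>, and hence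
  \<open>[\<Gamma>\<^sub>a, C]\<close> in \<open>so(g\<^sub>x)\<close>. Iterating, and evaluating at the origin, gives the condition.

  Sufficiency. Restricted to a ray the equation forces \<open>g\<^sub>x = \<Sum>\<^sub>n \<Gamma>\<^sub>x\<^sup>n \<cdot> g\<^sub>0 / n!\<close>. Under the condition,
  \<open>[\<Gamma>\<^sub>x, \<Gamma>\<^sub>v]\<close> lies in \<open>so(\<Gamma>\<^sub>x\<^sup>m \<cdot> g\<^sub>0)\<close> for all \<open>m\<close>, so \<open>\<Gamma>\<^sub>v\<close> can be moved past every factor \<open>\<Gamma>\<^sub>x\<close> and the
  derivative of \<open>\<Gamma>\<^sub>x\<^sup>n \<cdot> g\<^sub>0\<close> in the direction \<open>v\<close> is \<open>n \<Gamma>\<^sub>v \<cdot> (\<Gamma>\<^sub>x\<^sup>n\<^sup>-\<^sup>1 \<cdot> g\<^sub>0)\<close>. Differentiating the series term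
  by term therefore solves the equation (\<open>total_differential_equation_solvable\<close>). The solution is
  smooth because the equation expresses its derivatives through itself; it is symmetric and
  nondegenerate because parallel transport along the ray identifies it with \<open>g\<^sub>0\<close>
  (\<open>parallel_matrix_form_isometric_to_origin\<close>).
\<close>


section \<open>Symmetry of mixed second derivatives\<close>

text \<open>
  The mean value theorem is applied first in the direction \<open>v\<close> to the first difference in the
  direction \<open>w\<close>, and then in the direction \<open>w\<close> to the derivative that results.
\<close>

lemma second_difference_mean_value:
  fixes f :: "'a::real_normed_vector \<Rightarrow> real"
  assumes f: "\<And>x. (f has_derivative f' x) (at x)"
    and fv: "\<And>x. ((\<lambda>y. f' y v) has_derivative F x) (at x)"
    and h: "0 < h"
  obtains p where "norm (p - x) \<le> h * (norm v + norm w)"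
    and "f (x + h *\<^sub>R v + h *\<^sub>R w) - f (x + h *\<^sub>R v) - f (x + h *\<^sub>R w) + f x = h\<^sup>2 * F p w"
proof -
  have lin: "linear (f' y)" "linear (F y)" for y
    using f fv has_derivative_linear by blast+
  define \<phi> where "\<phi> s = f (x + s *\<^sub>R v + h *\<^sub>R w) - f (x + s *\<^sub>R v)" for s
  have "(\<phi> has_real_derivative f' (x + s *\<^sub>R v + h *\<^sub>R w) v - f' (x + s *\<^sub>R v) v) (at s)" for s
    unfolding \<phi>_def has_field_derivative_def
    by (rule has_derivative_eq_rhs, (rule derivative_intros has_derivative_compose[OF _ f])+)
      (auto simp: linear_cmul[OF lin(1)] algebra_simps)
  from MVT2[OF h this] obtain s where s: "0 < s" "s < h"
    "\<phi> h - \<phi> 0 = h * (f' (x + s *\<^sub>R v + h *\<^sub>R w) v - f' (x + s *\<^sub>R v) v)"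
    by auto
  define \<psi> where "\<psi> t = f' (x + s *\<^sub>R v + t *\<^sub>R w) v" for t
  have "(\<psi> has_real_derivative F (x + s *\<^sub>R v + t *\<^sub>R w) w) (at t)" for t
    unfolding \<psi>_def has_field_derivative_def
    by (rule has_derivative_eq_rhs, (rule derivative_intros has_derivative_compose[OF _ fv])+)
      (auto simp: linear_cmul[OF lin(2)] algebra_simps)
  from MVT2[OF h this] obtain t where t: "0 < t" "t < h"
    "\<psi> h - \<psi> 0 = h * F (x + s *\<^sub>R v + t *\<^sub>R w) w"
    by auto
  show thesis
  proof (rule that)
    have "norm (s *\<^sub>R v + t *\<^sub>R w) \<le> norm (s *\<^sub>R v) + norm (t *\<^sub>R w)"
      by (rule norm_triangle_ineq)
    also have "\<dots> \<le> h * norm v + h * norm w"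
      using s t by (auto intro!: add_mono mult_right_mono)
    finally show "norm (x + s *\<^sub>R v + t *\<^sub>R w - x) \<le> h * (norm v + norm w)"
      by (simp add: algebra_simps)
    show "f (x + h *\<^sub>R v + h *\<^sub>R w) - f (x + h *\<^sub>R v) - f (x + h *\<^sub>R w) + f x
        = h\<^sup>2 * F (x + s *\<^sub>R v + t *\<^sub>R w) w"
      using s(3) t(3) by (simp add: \<phi>_def \<psi>_def power2_eq_square algebra_simps)
  qed
qed

text \<open>
  The second difference of \<open>f\<close> is symmetric in \<open>v\<close> and \<open>w\<close>, so at each scale \<open>h\<close> the two mixed
  derivatives agree, though at different points \<open>p\<close> and \<open>q\<close> near \<open>x\<close>; by continuity they agree at \<open>x\<close>.
\<close>

lemma mixed_second_derivatives_eq: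
  fixes f :: "'a::real_normed_vector \<Rightarrow> real"
  assumes f: "\<And>x. (f has_derivative f' x) (at x)"
    and fv: "\<And>x. ((\<lambda>y. f' y v) has_derivative F x) (at x)"
    and fw: "\<And>x. ((\<lambda>y. f' y w) has_derivative G x) (at x)"
    and contF: "isCont (\<lambda>y. F y w) x" and contG: "isCont (\<lambda>y. G y v) x"
  shows "F x w = G x v"
proof -
  have "\<exists>p q. norm (p - x) \<le> h * (norm v + norm w) \<and> norm (q - x) \<le> h * (norm v + norm w)
      \<and> F p w = G q v" if h: "0 < h" for h
  proof -
    obtain p where p: "norm (p - x) \<le> h * (norm v + norm w)"
      "f (x + h *\<^sub>R v + h *\<^sub>R w) - f (x + h *\<^sub>R v) - f (x + h *\<^sub>R w) + f x = h\<^sup>2 * F p w"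
      using second_difference_mean_value[OF f fv h] by blast
    obtain q where q: "norm (q - x) \<le> h * (norm w + norm v)"
      "f (x + h *\<^sub>R w + h *\<^sub>R v) - f (x + h *\<^sub>R w) - f (x + h *\<^sub>R v) + f x = h\<^sup>2 * G q v"
      using second_difference_mean_value[OF f fw h] by blast
    have "h\<^sup>2 * F p w = h\<^sup>2 * G q v"
      using p(2) q(2) by (simp add: algebra_simps)
    with h p(1) q(1) show ?thesis by (auto simp: add.commute)
  qed
  then obtain p q where pq: "\<And>h. 0 < h \<Longrightarrow> norm (p h - x) \<le> h * (norm v + norm w)"
    "\<And>h. 0 < h \<Longrightarrow> norm (q h - x) \<le> h * (norm v + norm w)"
    "\<And>h. 0 < h \<Longrightarrow> F (p h) w = G (q h) v"
    by metis
  define e where "e n = inverse (real (Suc n))" for n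
  have e: "0 < e n" for n by (simp add: e_def)
  have bd: "(\<lambda>n. e n * (norm v + norm w)) \<longlonglongrightarrow> 0"
    unfolding e_def using tendsto_mult_left_zero[OF LIMSEQ_inverse_real_of_nat] by simp
  have p: "(\<lambda>n. p (e n)) \<longlonglongrightarrow> x"
    using Lim_null_comparison[OF _ bd, of "\<lambda>n. p (e n) - x"] pq(1)[OF e] by (simp add: LIM_zero_iff)
  have q: "(\<lambda>n. q (e n)) \<longlonglongrightarrow> x"
    using Lim_null_comparison[OF _ bd, of "\<lambda>n. q (e n) - x"] pq(2)[OF e] by (simp add: LIM_zero_iff)
  have "(\<lambda>n. G (q (e n)) v) \<longlonglongrightarrow> F x w"
    using isCont_tendsto_compose[OF contF p] pq(3)[OF e] by simp
  moreover have "(\<lambda>n. G (q (e n)) v) \<longlonglongrightarrow> G x v"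
    by (rule isCont_tendsto_compose[OF contG q])
  ultimately show ?thesis
    by (rule LIMSEQ_unique)
qed

section \<open>Linear total differential equations with constant coefficients\<close>

text \<open>
  \<open>R v\<close> is the coefficient operator of the equation \<open>dF\<^sub>x(v) = R v (F x)\<close> with \<open>F 0 = b\<close>. Commutation of
  the operators is demanded only on the vectors \<open>(R x)\<^sup>m b\<close> that the exponential series involves: on the
  whole space it would amount to flatness of the connection in the application to forms.
\<close>

locale commuting_orbit =
  bounded_bilinear R
  for R :: "'a::real_normed_vector \<Rightarrow> 'b::banach \<Rightarrow> 'b" +
  fixes b :: 'b
  assumes commute: "R x (R v ((R x ^^ m) b)) = R v (R x ((R x ^^ m) b))"
begin

lemma has_derivative_funpow:
  "((\<lambda>x. (R x ^^ Suc n) b) has_derivative (\<lambda>v. real (Suc n) *\<^sub>R R v ((R x ^^ n) b))) (at x)"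
proof (induction n)
  case 0
  show ?case by (auto intro!: derivative_eq_intros bounded_linear_imp_has_derivative bounded_linear_left)
next
  case (Suc n)
  have "((\<lambda>x. R x ((R x ^^ Suc n) b)) has_derivative
      (\<lambda>v. R x (real (Suc n) *\<^sub>R R v ((R x ^^ n) b)) + R v ((R x ^^ Suc n) b))) (at x)"
    by (rule FDERIV[OF has_derivative_ident Suc])
  moreover have "R x (real (Suc n) *\<^sub>R R v ((R x ^^ n) b)) + R v ((R x ^^ Suc n) b)
      = real (Suc (Suc n)) *\<^sub>R R v ((R x ^^ Suc n) b)" for v
  proof -
    have "R x (real (Suc n) *\<^sub>R R v ((R x ^^ n) b)) = real (Suc n) *\<^sub>R R v ((R x ^^ Suc n) b)"
      unfolding scaleR_right funpow.simps(2) o_apply by (subst commute) (rule refl)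
    then show ?thesis
      unfolding of_nat_Suc[of "Suc n"] scaleR_add_left scaleR_one by (simp only: add.commute)
  qed
  ultimately show ?case
    by (simp only: funpow.simps(2)[of "Suc n"] o_apply)
qed

lemma norm_funpow_le:
  assumes K: "\<And>a c. norm (R a c) \<le> norm a * norm c * K" and r: "0 \<le> K" "norm x \<le> r"
  shows "norm ((R x ^^ n) b) \<le> (r * K) ^ n * norm b"
proof (induction n)
  case (Suc n)
  have "norm (R x ((R x ^^ n) b)) \<le> norm x * K * norm ((R x ^^ n) b)"
    using K[of x "(R x ^^ n) b"] by (simp add: mult_ac)
  also have "\<dots> \<le> (r * K) * ((r * K) ^ n * norm b)"
  proof (rule mult_mono[OF _ Suc])
    show "norm x * K \<le> r * K"
      using r by (simp add: mult_right_mono)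
    show "0 \<le> r * K"
      using r(1) order_trans[OF norm_ge_zero r(2)] by simp
  qed simp
  finally show ?case by (simp add: mult_ac)
qed simp

text \<open>
  The solution is the exponential series \<open>\<Sum>\<^sub>n (R x)\<^sup>n b / n!\<close>. The partial sums \<open>S\<^sub>n\<close> satisfy
  \<open>dS\<^sub>n\<^sub>+\<^sub>1(v) = R v S\<^sub>n\<close> by the commutation hypothesis, so that uniform convergence of \<open>S\<^sub>n\<close> on balls
  already gives uniform convergence of the derivatives.
\<close>

lemma total_differential_equation_solvable:
  obtains F where "F 0 = b" "\<And>x. (F has_derivative (\<lambda>v. R v (F x))) (at x)"
proof -
  define f where "f n x = (R x ^^ n) b /\<^sub>R fact n" for n x
  define f' where "f' n x v = (case n of 0 \<Rightarrow> 0 | Suc m \<Rightarrow> R v (f m x))" for n x v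
  define F where "F x = (\<Sum>n. f n x)" for x
  obtain K where K: "0 < K" "\<And>a c. norm (R a c) \<le> norm a * norm c * K"
    using pos_bounded by blast
  have unif: "uniform_limit (ball 0 r) (\<lambda>n x. \<Sum>i<n. f i x) F sequentially" for r
    unfolding F_def
  proof (rule Weierstrass_m_test)
    show "norm (f n x) \<le> ((r * K) ^ n /\<^sub>R fact n) * norm b" if "x \<in> ball 0 r" for n x
      using norm_funpow_le[OF K(2), of x r n] K(1) that
      by (simp add: f_def divide_simps)
    show "summable (\<lambda>n. (r * K) ^ n /\<^sub>R fact n * norm b)"
      by (intro summable_mult2 summable_exp_generic)
  qed
  have sums: "(\<lambda>n. f n x) sums F x" for x
    using tendsto_uniform_limitI[OF unif[of "norm x + 1"], of x] by (simp add: sums_def)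
  have df: "(f n has_derivative f' n x) (at x)" for n x
  proof (cases n)
    case 0
    then show ?thesis by (auto simp: f_def[abs_def] f'_def[abs_def])
  next
    case (Suc m)
    have "(f (Suc m) has_derivative (\<lambda>v. (real (Suc m) *\<^sub>R R v ((R x ^^ m) b)) /\<^sub>R fact (Suc m))) (at x)"
      unfolding f_def by (intro has_derivative_scaleR_right has_derivative_funpow)
    also have "(\<lambda>v. (real (Suc m) *\<^sub>R R v ((R x ^^ m) b)) /\<^sub>R fact (Suc m)) = f' n x"
      by (rule ext) (simp add: f'_def f_def Suc scaleR_right divide_simps del: of_nat_Suc)
    finally show ?thesis by (simp add: Suc)
  qed
  have F': "(F has_derivative (\<lambda>v. R v (F x))) (at x)" for x
  proof -
    define r where "r = norm x + 1"
    have x: "x \<in> ball 0 r" by (simp add: r_def)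
    have "\<exists>g. \<forall>x\<in>ball 0 r. (\<lambda>n. f n x) sums g x \<and>
        (g has_derivative (\<lambda>v. R v (F x))) (at x within ball 0 r)"
    proof (rule has_derivative_series[OF convex_ball _ _ x sums])
      show "(f n has_derivative f' n y) (at y within ball 0 r)" for n y
        by (rule has_derivative_at_withinI[OF df])
      show "\<forall>\<^sub>F n in sequentially. \<forall>x\<in>ball 0 r. \<forall>h. norm ((\<Sum>i<n. f' i x h) - R h (F x)) \<le> e * norm h"
        (is "eventually ?P sequentially") if e: "0 < e" for e
      proof -
        have "\<forall>\<^sub>F n in sequentially. \<forall>x\<in>ball 0 r. dist (\<Sum>i<n. f i x) (F x) < e / K"
          by (rule uniform_limitD[OF unif]) (use e K(1) in simp)
        then have "\<forall>\<^sub>F n in sequentially. ?P (Suc n)"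
        proof eventually_elim
          case (elim n)
          show ?case
          proof (intro ballI allI)
            fix y h :: 'a assume y: "y \<in> ball 0 r"
            have "(\<Sum>i<Suc n. f' i y h) = R h (\<Sum>i<n. f i y)"
              by (simp only: sum.lessThan_Suc_shift f'_def) (simp add: sum_right)
            then have "norm ((\<Sum>i<Suc n. f' i y h) - R h (F y)) = norm (R h ((\<Sum>i<n. f i y) - F y))"
              by (simp add: diff_right)
            also have "\<dots> \<le> norm h * norm ((\<Sum>i<n. f i y) - F y) * K"
              by (rule K)
            also have "\<dots> \<le> norm h * (e / K) * K"
              using bspec[OF elim y] K(1)
              by (intro mult_right_mono mult_left_mono) (simp_all add: dist_norm)
            finally show "norm ((\<Sum>i<Suc n. f' i y h) - R h (F y)) \<le> e * norm h"
              using K(1) by (simp add: mult.commute)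
          qed
        qed
        then show ?thesis by (simp only: eventually_sequentially_Suc[of ?P])
      qed
    qed
    then obtain g where g: "\<forall>y\<in>ball 0 r. (\<lambda>n. f n y) sums g y \<and>
        (g has_derivative (\<lambda>v. R v (F y))) (at y within ball 0 r)" ..
    have gF: "g y = F y" if "y \<in> ball 0 r" for y
      by (rule sums_unique2[OF bspec[OF g that, THEN conjunct1] sums])
    have "(F has_derivative (\<lambda>v. R v (F x))) (at x within ball 0 r)"
      by (rule has_derivative_transform[OF x _ bspec[OF g x, THEN conjunct2]]) (simp add: gF)
    then show ?thesis
      by (simp only: at_within_open[OF x open_ball])
  qed
  have "f n 0 = (if n = 0 then b else 0)" for n
    by (cases n) (simp_all add: f_def zero_left)
  then have "(\<lambda>n. f n 0) sums b"
    using sums_single[of 0 "\<lambda>_. b"] by simp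
  then have "F 0 = b"
    by (rule sums_unique2[OF sums])
  then show thesis
    using F' by (rule that)
qed

end


section \<open>The derivation action of endomorphisms on bilinear forms\<close>

text \<open>
  The series above lives in a Banach space; matrices serve as the normed space of bilinear forms.
\<close>

definition matrix_form :: "real ^ 'n ^ 'n \<Rightarrow> real ^ 'n \<Rightarrow> real ^ 'n \<Rightarrow> real" where
  "matrix_form M u w = u \<bullet> (M *v w)"

definition derived_form :: "('a \<Rightarrow> 'a) \<Rightarrow> ('a \<Rightarrow> 'a \<Rightarrow> real) \<Rightarrow> 'a \<Rightarrow> 'a \<Rightarrow> real" where
  "derived_form A B u w = B (A u) w + B u (A w)"

text \<open>
  The derivation action \<open>derived_form\<close> transported to matrices; see \<open>matrix_form_derived_matrix\<close>.
\<close>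

definition derived_matrix :: "(real ^ 'n \<Rightarrow> real ^ 'n) \<Rightarrow> real ^ 'n ^ 'n \<Rightarrow> real ^ 'n ^ 'n" where
  "derived_matrix A M = transpose (matrix A) ** M + M ** matrix A"

lemma bilinear_imp_linear_right: "bilinear B \<Longrightarrow> linear (B v)"
  by (simp add: bilinear_def)

lemma linear_ad: "linear A \<Longrightarrow> linear C \<Longrightarrow> linear (ad A C)"
  unfolding ad_def by (rule linear_compose_sub; rule linear_compose[unfolded o_def])

lemma so_iff_derived_form: "A \<in> so B \<longleftrightarrow> linear A \<and> (\<forall>u w. derived_form A B u w = 0)"
  by (simp add: so_def derived_form_def)

text \<open>
  For \<open>C \<in> so B\<close> the term \<open>A \<cdot> (C \<cdot> B)\<close> of the commutator relation vanishes, which leaves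
  \<open>C \<cdot> (A \<cdot> B) = [A, C] \<cdot> B\<close>. Read from left to right this raises the power of \<open>ad A\<close>, as needed for
  necessity; read from right to left it replaces \<open>B\<close> by \<open>A \<cdot> B\<close>, as needed for sufficiency.
\<close>

lemma so_derived_form_iff:
  assumes B: "bilinear B" and A: "linear A" and C: "C \<in> so B"
  shows "C \<in> so (derived_form A B) \<longleftrightarrow> ad A C \<in> so B"
proof -
  have lin: "linear C" and skew: "\<And>u w. B (C u) w + B u (C w) = 0"
    using C by (auto simp: so_def)
  have "derived_form C (derived_form A B) u w = derived_form (ad A C) B u w" for u w
    using skew[of "A u" w] skew[of u "A w"]
    by (simp add: derived_form_def ad_def bilinear_lsub[OF B] bilinear_rsub[OF B])
  then show ?thesis
    by (simp add: so_iff_derived_form lin linear_ad[OF A lin])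
qed

lemma derived_form_commute_iff:
  assumes B: "bilinear B" and A: "linear A" and C: "linear C"
  shows "derived_form A (derived_form C B) = derived_form C (derived_form A B) \<longleftrightarrow> ad A C \<in> so B"
proof -
  have "derived_form A (derived_form C B) u w - derived_form C (derived_form A B) u w
      = - derived_form (ad A C) B u w" for u w
    by (simp add: derived_form_def ad_def bilinear_lsub[OF B] bilinear_rsub[OF B])
  then have "derived_form A (derived_form C B) u w = derived_form C (derived_form A B) u w \<longleftrightarrow>
      derived_form (ad A C) B u w = 0" for u w
    by (metis eq_iff_diff_eq_0 neg_equal_0_iff_equal)
  then show ?thesis
    by (simp add: so_iff_derived_form linear_ad[OF A C] fun_eq_iff)
qed

lemma bounded_bilinear_matrix_vector_mult: "bounded_bilinear ((*v) :: real ^ 'n ^ 'm \<Rightarrow> _)"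
  unfolding bilinear_conv_bounded_bilinear[symmetric]
  by (auto simp: bilinear_def linear_iff matrix_vector_mult_add_rdistrib matrix_vector_right_distrib
      scaleR_matrix_vector_assoc[symmetric] matrix_vector_mult_scaleR)

lemma bilinear_matrix_form: "bilinear (matrix_form M)"
  by (auto simp: bilinear_def linear_iff matrix_form_def inner_add matrix_vector_right_distrib
      matrix_vector_mult_scaleR)

lemma matrix_form_eqI: "matrix_form M = matrix_form N \<Longrightarrow> M = N"
  by (simp add: matrix_eq matrix_form_def fun_eq_iff) (metis vector_eq_ldot)

lemma bilinear_eq_matrix_form:
  assumes "bilinear B"
  obtains M where "matrix_form M = B"
proof
  show "matrix_form (\<chi> i j. B (axis i 1) (axis j 1)) = B"
    by (rule bilinear_eq_stdbasis[OF bilinear_matrix_form assms])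
      (auto simp: matrix_form_def Basis_vec_def inner_axis' matrix_vector_mul_component
        inner_axis)
qed

lemma matrix_form_derived_matrix:
  assumes "linear A"
  shows "matrix_form (derived_matrix A M) = derived_form A (matrix_form M)"
proof (intro ext)
  fix u w
  have "u \<bullet> (transpose (matrix A) *v z) = A u \<bullet> z" for z
    by (metis dot_lmul_matrix vector_transpose_matrix matrix_vector_mul(2)[OF assms])
  then show "matrix_form (derived_matrix A M) u w = derived_form A (matrix_form M) u w"
    by (simp add: matrix_form_def derived_matrix_def derived_form_def
        matrix_vector_mult_add_rdistrib inner_add_right matrix_vector_mul_assoc[symmetric]
        matrix_vector_mul(2)[OF assms, THEN fun_cong] del: transpose_matrix_vector)
qed

lemma matrix_form_add: "matrix_form (M + N) u w = matrix_form M u w + matrix_form N u w"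
  and matrix_form_scaleR: "matrix_form (c *\<^sub>R M) u w = c * matrix_form M u w"
  by (simp_all add: matrix_form_def matrix_vector_mult_add_rdistrib inner_add_right
      scaleR_matrix_vector_assoc[symmetric])

lemma bounded_bilinear_derived_matrix:
  fixes \<Gamma> :: "real ^ 'n \<Rightarrow> real ^ 'n \<Rightarrow> real ^ 'n"
  assumes \<Gamma>: "bilinear \<Gamma>"
  shows "bounded_bilinear (\<lambda>v. derived_matrix (\<Gamma> v))"
proof -
  note lin = bilinear_imp_linear_right[OF \<Gamma>]
  have "bilinear (\<lambda>v. derived_matrix (\<Gamma> v))"
    unfolding bilinear_def linear_iff
    by (auto intro!: matrix_form_eqI ext
        simp: matrix_form_derived_matrix[OF lin] matrix_form_add matrix_form_scaleR derived_form_def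
          bilinear_ladd[OF \<Gamma>] bilinear_lmul[OF \<Gamma>] algebra_simps
          bilinear_ladd[OF bilinear_matrix_form] bilinear_radd[OF bilinear_matrix_form]
          bilinear_lmul[OF bilinear_matrix_form] bilinear_rmul[OF bilinear_matrix_form])
  then show ?thesis
    by (simp add: bilinear_conv_bounded_bilinear)
qed

lemma has_derivative_matrix_form:
  assumes F: "(F has_derivative F') (at x)"
    and Y: "(Y has_derivative Y') (at x)" and Z: "(Z has_derivative Z') (at x)"
  shows "((\<lambda>p. matrix_form (F p) (Y p) (Z p)) has_derivative
    (\<lambda>v. matrix_form (F' v) (Y x) (Z x) + matrix_form (F x) (Y' v) (Z x)
      + matrix_form (F x) (Y x) (Z' v))) (at x)"
  unfolding matrix_form_def
  by (rule has_derivative_eq_rhs[OF has_derivative_inner[OF Y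
        bounded_bilinear.FDERIV[OF bounded_bilinear_matrix_vector_mult F Z]]])
    (auto simp: fun_eq_iff inner_add_right)

text \<open>
  Here \<open>P t = exp(t L)\<close>. With the real line as domain, all coefficient operators are
  multiples of a single one and commute.
\<close>

lemma exponential_curve:
  fixes L :: "real ^ 'n ^ 'n"
  obtains P where "P 0 = mat 1" "\<And>t. (P has_derivative (\<lambda>s. s *\<^sub>R (L ** P t))) (at t)"
proof -
  have "bilinear (\<lambda>s M. s *\<^sub>R (L ** M))"
    by (auto simp: bilinear_def linear_iff matrix_add_ldistrib matrix_scalar_ac scalar_matrix_assoc[symmetric] algebra_simps)
  then interpret bounded_bilinear "\<lambda>s M. s *\<^sub>R (L ** M)"
    by (simp add: bilinear_conv_bounded_bilinear)
  interpret commuting_orbit "\<lambda>s M. s *\<^sub>R (L ** M)" "mat 1"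
    by unfold_locales (simp add: matrix_scalar_ac scalar_matrix_assoc[symmetric] mult.commute)
  show thesis
    by (rule total_differential_equation_solvable) (rule that)
qed

section \<open>Parallel metrics as solutions of a differential equation\<close>

lemma Ck_add: "Ck k f \<Longrightarrow> Ck k g \<Longrightarrow> Ck k (\<lambda>x. f x + g x)"
proof (induction k arbitrary: f g)
  case (Suc k)
  have "frechet_derivative (\<lambda>x. f x + g x) (at x) =
      (\<lambda>v. frechet_derivative f (at x) v + frechet_derivative g (at x) v)" for x
    using Suc.prems
    by (intro frechet_derivative_at[symmetric] has_derivative_add)
      (auto simp: frechet_derivative_works[symmetric])
  then show ?case
    using Suc by (auto intro!: Suc.IH)
qed (auto intro: continuous_on_add)

lemma smooth_const: "smooth (\<lambda>x. c)"
proof -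
  have "Ck k (\<lambda>x. c)" for k
    by (induction k arbitrary: c) auto
  then show ?thesis unfolding smooth_def by blast
qed

lemma smooth_imp_differentiable: "smooth f \<Longrightarrow> f differentiable at x"
  unfolding smooth_def by (metis Ck.simps(2))

text \<open>
  \<open>\<nabla>g = 0\<close> tested on constant vector fields.
\<close>

definition parallel :: "('a::euclidean_space \<Rightarrow> 'a \<Rightarrow> 'a) \<Rightarrow> ('a \<Rightarrow> 'a \<Rightarrow> 'a \<Rightarrow> real) \<Rightarrow> bool" where
  "parallel \<Gamma> g \<longleftrightarrow> (\<forall>u w x. ((\<lambda>p. g p u w) has_derivative
     (\<lambda>v. derived_form (\<Gamma> v) (g x) u w)) (at x))"

lemma parallelD:
  "parallel \<Gamma> g \<Longrightarrow> ((\<lambda>p. g p u w) has_derivative (\<lambda>v. derived_form (\<Gamma> v) (g x) u w)) (at x)"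
  by (simp add: parallel_def)

lemma parallel_derived_form:
  assumes "parallel \<Gamma> g"
  shows "((\<lambda>p. derived_form A (g p) u w) has_derivative
    (\<lambda>v. derived_form A (derived_form (\<Gamma> v) (g x)) u w)) (at x)"
  unfolding derived_form_def[of A] by (intro has_derivative_add parallelD assms)

text \<open>
  The first derivatives of the components are sums of components, so each degree of
  differentiability yields the next.
\<close>

lemma parallel_imp_smooth:
  assumes "parallel \<Gamma> g"
  shows "smooth (\<lambda>x. g x u w)"
proof -
  have "Ck k (\<lambda>x. g x u w)" for k
  proof (induction k arbitrary: u w)
    case 0
    show ?case
      using has_derivative_continuous[OF parallelD[OF assms]]
      by (simp add: continuous_at_imp_continuous_on)
  next
    case (Suc k)
    have "frechet_derivative (\<lambda>p. g p u w) (at x) v = derived_form (\<Gamma> v) (g x) u w" for x v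
      by (simp add: frechet_derivative_at[OF parallelD[OF assms], symmetric])
    then show ?case
      by (auto simp: derived_form_def intro: Ck_add Suc differentiableI parallelD[OF assms])
  qed
  then show ?thesis by (simp add: smooth_def)
qed

lemma levi_civita_imp_parallel:
  assumes g: "semi_riemannian_metric g" and lc: "levi_civita_connection g (connection_of \<Gamma>)"
  shows "parallel \<Gamma> g"
  unfolding parallel_def
proof (intro allI)
  fix u w x
  have "frechet_derivative (\<lambda>p. g p u w) (at x) v = derived_form (\<Gamma> v) (g x) u w" for v
  proof -
    have "covariant_derivative_form (connection_of \<Gamma>) g (\<lambda>_. v) (\<lambda>_. u) (\<lambda>_. w) x = 0"
      using lc smooth_const unfolding levi_civita_connection_def by blast
    then show ?thesis
      by (simp add: covariant_derivative_form_def connection_of_def derived_form_def)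
  qed
  then have "frechet_derivative (\<lambda>p. g p u w) (at x) = (\<lambda>v. derived_form (\<Gamma> v) (g x) u w)"
    by blast
  moreover have "(\<lambda>p. g p u w) differentiable at x"
    using g smooth_imp_differentiable by (auto simp: semi_riemannian_metric_def)
  ultimately show "((\<lambda>p. g p u w) has_derivative (\<lambda>v. derived_form (\<Gamma> v) (g x) u w)) (at x)"
    by (metis frechet_derivative_works)
qed

lemma torsion_free_connection_of:
  assumes "symmetric_bilinear \<Gamma>"
  shows "torsion_free (connection_of \<Gamma>)"
  using assms by (auto simp: symmetric_bilinear_def torsion_free_def connection_of_def field_bracket_def)

section \<open>Necessity\<close>

text \<open>
  The statement has to be made at every point \<open>x\<close>, since the induction step differentiates in \<open>x\<close>.
\<close>

lemma parallel_imp_ad_iterates_in_so: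
  fixes \<Gamma> :: "'a::euclidean_space \<Rightarrow> 'a \<Rightarrow> 'a"
  assumes \<Gamma>: "bilinear \<Gamma>" and g: "\<And>x. bilinear (g x)" and par: "parallel \<Gamma> g"
  shows "(ad (\<Gamma> a) ^^ k) (ad (\<Gamma> b) (\<Gamma> c)) \<in> so (g x)"
proof (induction k arbitrary: x)
  case 0
  note lin = bilinear_imp_linear_right[OF \<Gamma>]
  have cont: "isCont (\<lambda>p. derived_form A (derived_form C (g p)) u w) x" for A C u w
    unfolding derived_form_def by (intro continuous_intros has_derivative_continuous[OF parallelD[OF par]])
  have "derived_form (\<Gamma> c) (derived_form (\<Gamma> b) (g x)) u w =
      derived_form (\<Gamma> b) (derived_form (\<Gamma> c) (g x)) u w" for u w
    using mixed_second_derivatives_eq[OF parallelD[OF par] parallel_derived_form[OF par]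
        parallel_derived_form[OF par] cont cont]
    by simp
  then have "derived_form (\<Gamma> b) (derived_form (\<Gamma> c) (g x)) =
      derived_form (\<Gamma> c) (derived_form (\<Gamma> b) (g x))"
    by (intro ext) (rule sym)
  then show ?case
    using derived_form_commute_iff[OF g lin lin] by (metis (no_types) funpow_0)
next
  case (Suc k)
  note lin = bilinear_imp_linear_right[OF \<Gamma>]
  let ?C = "(ad (\<Gamma> a) ^^ k) (ad (\<Gamma> b) (\<Gamma> c))"
  have C: "linear ?C" "derived_form ?C (g p) u w = 0" for p u w
    using Suc by (auto simp: so_iff_derived_form)
  \<comment> \<open>This is the derivative of the constant function \<open>C \<cdot> g\<close> in the direction \<open>v\<close>.\<close>
  have "derived_form ?C (derived_form (\<Gamma> v) (g x)) u w = 0" for v u w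
    using has_derivative_unique[OF parallel_derived_form[OF par, of ?C u w x], of "\<lambda>_. 0"]
    by (simp add: C(2) fun_eq_iff)
  then have "?C \<in> so (derived_form (\<Gamma> a) (g x))"
    by (simp add: so_iff_derived_form C(1))
  then show ?case
    using so_derived_form_iff[OF g lin Suc] by simp
qed

section \<open>Sufficiency\<close>

text \<open>
  Induction on \<open>m\<close> trades one factor \<open>A\<close> acting on the form for one more application of \<open>ad A\<close>; this is
  why the condition is needed for all powers of \<open>ad A\<close>.
\<close>

lemma ad_iterates_in_so_funpow:
  assumes A: "linear A" and C: "\<And>k. (ad A ^^ k) C \<in> so (matrix_form M)"
  shows "(ad A ^^ k) C \<in> so (matrix_form ((derived_matrix A ^^ m) M))"
proof (induction m arbitrary: k)
  case (Suc m)
  have "ad A ((ad A ^^ k) C) \<in> so (matrix_form ((derived_matrix A ^^ m) M))"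
    using Suc[of "Suc k"] by simp
  then show ?case
    using so_derived_form_iff[OF bilinear_matrix_form A Suc[of k]]
    by (simp add: matrix_form_derived_matrix[OF A])
qed (simp add: C)

lemma parallel_matrix_form_exists:
  fixes \<Gamma> :: "real ^ 'n \<Rightarrow> real ^ 'n \<Rightarrow> real ^ 'n"
  assumes \<Gamma>: "bilinear \<Gamma>"
    and so: "\<And>a b k. (ad (\<Gamma> a) ^^ k) (ad (\<Gamma> a) (\<Gamma> b)) \<in> so (matrix_form M)"
  obtains F where "F 0 = M" "\<And>x. (F has_derivative (\<lambda>v. derived_matrix (\<Gamma> v) (F x))) (at x)"
proof -
  note lin = bilinear_imp_linear_right[OF \<Gamma>]
  interpret bounded_bilinear "\<lambda>v. derived_matrix (\<Gamma> v)"
    by (rule bounded_bilinear_derived_matrix[OF \<Gamma>])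
  interpret commuting_orbit "\<lambda>v. derived_matrix (\<Gamma> v)" M
  proof
    fix x v m
    let ?N = "(derived_matrix (\<Gamma> x) ^^ m) M"
    have "(ad (\<Gamma> x) ^^ 0) (ad (\<Gamma> x) (\<Gamma> v)) \<in> so (matrix_form ?N)"
      by (rule ad_iterates_in_so_funpow[OF lin so])
    then have "ad (\<Gamma> x) (\<Gamma> v) \<in> so (matrix_form ?N)"
      by simp
    then have "derived_form (\<Gamma> x) (derived_form (\<Gamma> v) (matrix_form ?N)) =
        derived_form (\<Gamma> v) (derived_form (\<Gamma> x) (matrix_form ?N))"
      using derived_form_commute_iff[OF bilinear_matrix_form lin lin] by blast
    then show "derived_matrix (\<Gamma> x) (derived_matrix (\<Gamma> v) ?N) =
        derived_matrix (\<Gamma> v) (derived_matrix (\<Gamma> x) ?N)"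
      by (intro matrix_form_eqI) (simp add: matrix_form_derived_matrix[OF lin])
  qed
  show thesis
    by (rule total_differential_equation_solvable) (rule that)
qed

context
  fixes \<Gamma> :: "real ^ 'n \<Rightarrow> real ^ 'n \<Rightarrow> real ^ 'n" and F :: "real ^ 'n \<Rightarrow> real ^ 'n ^ 'n"
  assumes \<Gamma>: "bilinear \<Gamma>"
    and F: "\<And>x. (F has_derivative (\<lambda>v. derived_matrix (\<Gamma> v) (F x))) (at x)"
begin

text \<open>
  The metric Leibniz rule for arbitrary, not only constant, vector fields.
\<close>

lemma has_derivative_parallel_matrix_form:
  assumes "(Y has_derivative Y') (at x)" "(Z has_derivative Z') (at x)"
  shows "((\<lambda>p. matrix_form (F p) (Y p) (Z p)) has_derivative
    (\<lambda>v. matrix_form (F x) (Y' v + \<Gamma> v (Y x)) (Z x)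
       + matrix_form (F x) (Y x) (Z' v + \<Gamma> v (Z x)))) (at x)"
  by (rule has_derivative_eq_rhs[OF has_derivative_matrix_form[OF F assms]])
    (simp add: matrix_form_derived_matrix[OF bilinear_imp_linear_right[OF \<Gamma>]] derived_form_def fun_eq_iff
      bilinear_ladd[OF bilinear_matrix_form] bilinear_radd[OF bilinear_matrix_form])

lemma parallel_matrix_form: "parallel \<Gamma> (\<lambda>x. matrix_form (F x))"
  unfolding parallel_def derived_form_def
  by (intro allI has_derivative_eq_rhs[OF has_derivative_parallel_matrix_form[OF has_derivative_const has_derivative_const]])
    simp

lemma parallel_matrix_form_covariant_derivative:
  assumes "Y differentiable at x" "Z differentiable at x"
  shows "covariant_derivative_form (connection_of \<Gamma>) (\<lambda>x. matrix_form (F x)) X Y Z x = 0"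
proof -
  note Y = assms(1)[unfolded frechet_derivative_works] and Z = assms(2)[unfolded frechet_derivative_works]
  show ?thesis
    unfolding covariant_derivative_form_def connection_of_def
      frechet_derivative_at[OF has_derivative_parallel_matrix_form[OF Y Z], symmetric]
    by simp
qed

text \<open>
  \<open>T = exp(-\<Gamma>\<^sub>x)\<close> is parallel transport along the segment from the origin to \<open>x\<close>: the curves
  \<open>exp(-t \<Gamma>\<^sub>x) a\<close> are parallel vector fields along \<open>t \<mapsto> t x\<close>, so the form takes constant values on them.
\<close>

lemma parallel_matrix_form_isometric_to_origin:
  obtains T where "linear T" "\<And>a b. matrix_form (F x) (T a) (T b) = matrix_form (F 0) a b"
proof -
  obtain P where P: "P 0 = mat 1" "\<And>t. (P has_derivative (\<lambda>s. s *\<^sub>R (matrix (\<lambda>u. - \<Gamma> x u) ** P t))) (at t)"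
    using exponential_curve by blast
  show thesis
  proof (rule that[of "(*v) (P 1)"])
    fix a b
    define h where "h t = matrix_form (F (t *\<^sub>R x)) (P t *v a) (P t *v b)" for t
    have Pv: "((\<lambda>t. P t *v c) has_derivative (\<lambda>s. - (s *\<^sub>R \<Gamma> x (P t *v c)))) (at t)" for c t
      by (rule has_derivative_eq_rhs[OF bounded_linear.has_derivative[OF
              bounded_bilinear.bounded_linear_left[OF bounded_bilinear_matrix_vector_mult] P(2)]])
        (simp add: fun_eq_iff scaleR_matrix_vector_assoc[symmetric] matrix_vector_mul_assoc[symmetric]
            matrix_vector_mul(2)[OF linear_compose_neg[OF bilinear_imp_linear_right[OF \<Gamma>]], THEN fun_cong])
    have Ft: "((\<lambda>t. F (t *\<^sub>R x)) has_derivative (\<lambda>s. derived_matrix (\<Gamma> (s *\<^sub>R x)) (F (t *\<^sub>R x)))) (at t)" for t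
      by (rule has_derivative_compose[OF _ F]) (auto intro!: derivative_eq_intros)
    have "(h has_derivative (\<lambda>s. 0)) (at t)" for t
      unfolding h_def
      by (rule has_derivative_eq_rhs[OF has_derivative_matrix_form[OF Ft Pv Pv]])
        (simp add: fun_eq_iff matrix_form_derived_matrix[OF bilinear_imp_linear_right[OF \<Gamma>]] derived_form_def
          bilinear_lmul[OF \<Gamma>] bilinear_lneg[OF bilinear_matrix_form] bilinear_rneg[OF bilinear_matrix_form]
          bilinear_lmul[OF bilinear_matrix_form] bilinear_rmul[OF bilinear_matrix_form])
    then have "h 1 = h 0"
      by (intro has_derivative_zero_unique[of UNIV h]) auto
    then show "matrix_form (F x) (P 1 *v a) (P 1 *v b) = matrix_form (F 0) a b"
      by (simp add: h_def P(1))
  qed simp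
qed

text \<open>
  Nondegeneracy at the origin makes the isometry \<open>T\<close> injective, hence surjective for reasons of
  dimension; every vector at \<open>x\<close> is thus the transport of one at the origin.
\<close>

lemma parallel_matrix_form_symmetric_nondegenerate:
  assumes sym: "symmetric_bilinear (matrix_form (F 0))" and nd: "nondegenerate (matrix_form (F 0))"
  shows "symmetric_bilinear (matrix_form (F x))" "nondegenerate (matrix_form (F x))"
proof -
  obtain T where T: "linear T" "\<And>a b. matrix_form (F x) (T a) (T b) = matrix_form (F 0) a b"
    using parallel_matrix_form_isometric_to_origin by blast
  have "a = 0" if "T a = 0" for a
    using nd T(2)[of a] that bilinear_lzero[OF bilinear_matrix_form, of "F x"]
    by (simp add: nondegenerate_def)
  then have "surj T"
    using T(1) by (simp add: linear_injective_0 linear_injective_imp_surjective)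
  then have T_onto: "\<exists>a. u = T a" for u
    by (metis surjD)
  show "symmetric_bilinear (matrix_form (F x))"
    unfolding symmetric_bilinear_def
  proof (intro conjI allI bilinear_matrix_form)
    fix u w
    show "matrix_form (F x) u w = matrix_form (F x) w u"
      using T_onto[of u] T_onto[of w] T(2) sym by (auto simp: symmetric_bilinear_def)
  qed
  show "nondegenerate (matrix_form (F x))"
    unfolding nondegenerate_def
  proof (intro allI impI)
    fix u assume u: "\<forall>w. matrix_form (F x) u w = 0"
    obtain a where a: "u = T a" using T_onto by blast
    have "matrix_form (F 0) a b = 0" for b
      using u T(2) a by metis
    then show "u = 0"
      using nd a linear_0[OF T(1)] by (auto simp: nondegenerate_def)
  qed
qed

end

theorem proposition3p2:
  fixes \<Gamma> :: "real ^ 'n \<Rightarrow> real ^ 'n \<Rightarrow> real ^ 'n"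
    and g0 :: "real ^ 'n \<Rightarrow> real ^ 'n \<Rightarrow> real"
  assumes "symmetric_bilinear \<Gamma>"
    and "symmetric_bilinear g0" and "nondegenerate g0"
  shows "(\<exists>g. semi_riemannian_metric g \<and> g 0 = g0 \<and>
              levi_civita_connection g (connection_of \<Gamma>)) \<longleftrightarrow>
         (\<forall>X \<in> range \<Gamma>. \<forall>Y \<in> range \<Gamma>. \<forall>Z \<in> range \<Gamma>. \<forall>k. (ad X ^^ k) (ad Y Z) \<in> so g0)"
proof
  have \<Gamma>: "bilinear \<Gamma>"
    using assms(1) by (simp add: symmetric_bilinear_def)
  assume "\<exists>g. semi_riemannian_metric g \<and> g 0 = g0 \<and> levi_civita_connection g (connection_of \<Gamma>)"
  then obtain g where g: "semi_riemannian_metric g" "g 0 = g0"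
    "levi_civita_connection g (connection_of \<Gamma>)" by blast
  have "bilinear (g x)" for x
    using g(1) by (auto simp: semi_riemannian_metric_def symmetric_bilinear_def)
  from parallel_imp_ad_iterates_in_so[OF \<Gamma> this levi_civita_imp_parallel[OF g(1,3)], of _ _ _ _ 0]
  show "\<forall>X \<in> range \<Gamma>. \<forall>Y \<in> range \<Gamma>. \<forall>Z \<in> range \<Gamma>. \<forall>k. (ad X ^^ k) (ad Y Z) \<in> so g0"
    by (auto simp: g(2))
next
  have \<Gamma>: "bilinear \<Gamma>" and g0: "bilinear g0"
    using assms(1,2) by (simp_all add: symmetric_bilinear_def)
  assume so: "\<forall>X \<in> range \<Gamma>. \<forall>Y \<in> range \<Gamma>. \<forall>Z \<in> range \<Gamma>. \<forall>k. (ad X ^^ k) (ad Y Z) \<in> so g0"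
  obtain M where M: "matrix_form M = g0"
    using bilinear_eq_matrix_form[OF g0] by blast
  obtain F where F: "F 0 = M" "\<And>x. (F has_derivative (\<lambda>v. derived_matrix (\<Gamma> v) (F x))) (at x)"
    using parallel_matrix_form_exists[OF \<Gamma>, of M] so M by blast
  let ?g = "\<lambda>x. matrix_form (F x)"
  have "semi_riemannian_metric ?g"
    using parallel_imp_smooth[OF parallel_matrix_form[OF \<Gamma> F(2)]]
      parallel_matrix_form_symmetric_nondegenerate[OF \<Gamma> F(2)] assms(2,3)
    by (auto simp: semi_riemannian_metric_def F(1) M)
  moreover have "levi_civita_connection ?g (connection_of \<Gamma>)"
    unfolding levi_civita_connection_def
    by (auto intro!: torsion_free_connection_of[OF assms(1)]
        parallel_matrix_form_covariant_derivative[OF \<Gamma> F(2)] smooth_imp_differentiable)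
  ultimately show "\<exists>g. semi_riemannian_metric g \<and> g 0 = g0 \<and> levi_civita_connection g (connection_of \<Gamma>)"
    using F(1) M by (intro exI[of _ ?g]) simp
qed

end
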